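(* Let $p \ge 5$ and $p \le q \le 4 + \binom{p-2}{\lfloor \frac{p-2}{2} \rfloor}$. Then $f(K(3,p,q)) = 2$.
   Context: $K(3,p,q)$ is the complete tripartite graph with parts of sizes $3$, $p$, $q$. A strong orientation of a graph is an orientation of all edges making the digraph strongly connected; the diameter of a strongly connected digraph is the maximum directed distance between ordered pairs of vertices. The oriented diameter $f(G)$ is the minimum diameter over all strong orientations of $G$. *)

theory Defs
  imports "Graph_Theory.Graph_Theory"
begin

text \<open>
  As in \<^theory>\<open>Graph_Theory.Digraph\<close>, an undirected simple graph is a finite, loop-free, symmetric
  digraph: the edge \<open>uv\<close> is represented by the two arcs \<open>(u, v)\<close> and \<open>(v, u)\<close>.
\<close>

definition complete_tripartite :: "nat \<Rightarrow> nat \<Rightarrow> nat \<Rightarrow> 'a pair_pre_digraph \<Rightarrow> bool" where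
  "complete_tripartite a b c G \<longleftrightarrow> pair_graph G \<and>
     (\<exists>U V W. pverts G = U \<union> V \<union> W \<and> U \<inter> V = {} \<and> U \<inter> W = {} \<and> V \<inter> W = {} \<and>
        card U = a \<and> card V = b \<and> card W = c \<and>
        parcs G = U \<times> V \<union> V \<times> U \<union> U \<times> W \<union> W \<times> U \<union> V \<times> W \<union> W \<times> V)"

text \<open>Exactly one of the two arcs representing each edge is kept.\<close>

definition orientation :: "'a pair_pre_digraph \<Rightarrow> 'a pair_pre_digraph \<Rightarrow> bool" where
  "orientation D G \<longleftrightarrow> pverts D = pverts G \<and>
     parcs D \<union> (parcs D)\<inverse> = parcs G \<and> parcs D \<inter> (parcs D)\<inverse> = {}"

definition strong_orientation :: "'a pair_pre_digraph \<Rightarrow> 'a pair_pre_digraph \<Rightarrow> bool" where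
  "strong_orientation D G \<longleftrightarrow> orientation D G \<and> strongly_connected (with_proj D)"

text \<open>
  With unit arc costs, the cost of a walk is its number of arcs, so \<open>\<mu>\<close> is the usual distance.
\<close>

definition digraph_dist :: "'a pair_pre_digraph \<Rightarrow> 'a \<Rightarrow> 'a \<Rightarrow> ereal" where
  "digraph_dist D u v = wf_digraph.\<mu> (with_proj D) (\<lambda>_. 1) u v"

definition diameter :: "'a pair_pre_digraph \<Rightarrow> ereal" where
  "diameter D = (SUP (u, v) \<in> pverts D \<times> pverts D. digraph_dist D u v)"

text \<open>
  A finite graph has finitely many orientations, so the infimum is a minimum whenever a strong
  orientation exists; otherwise it is \<open>\<infinity>\<close>.  Likewise the supremum above is a maximum for a finite
  nonempty digraph.
\<close>

definition oriented_diameter :: "'a pair_pre_digraph \<Rightarrow> ereal" where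
  "oriented_diameter G = (INF D \<in> {D. strong_orientation D G}. diameter D)"

end

theory Submission
  imports Defs
begin

text \<open>
  Let \<open>{a, b, c}\<close>, \<open>V\<close> and \<open>W\<close> be the parts, and let \<open>k = p div 2\<close>. Orient \<open>a \<rightarrow> V \<rightarrow> b \<rightarrow> W \<rightarrow> a\<close> and give
  every \<open>z \<in> W\<close> its own \<open>k\<close>-element out-neighbourhood \<open>A z \<subseteq> V\<close>. Distinct \<open>k\<close>-sets form an antichain,
  which gives paths of length two inside \<open>W\<close>; for paths inside \<open>V\<close> the sets \<open>A z\<close> must separate points,
  and the at most \<open>p \<le> q\<close> cyclic intervals of length \<open>k\<close> already do so. The third vertex \<open>c\<close> receives all
  of \<open>V\<close> except some \<open>y0\<close> and a single \<open>z1 \<in> W\<close> with \<open>y0 \<notin> A z1\<close>, and dominates everything else.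
  There is room for all of \<open>W\<close> because \<open>4 + ((p - 2) choose ((p - 2) div 2)) \<le> p choose k\<close>.
\<close>

section \<open>Separating families of subsets of a fixed size\<close>

lemma nat_mod_eq_close:
  fixes a b n :: nat
  assumes "a mod n = b mod n" "a \<le> b" "b < a + n"
  shows "a = b"
proof -
  have "n dvd b - a" using assms(1,2) by (metis mod_eq_dvd_iff_nat)
  moreover have "b - a < n" using assms(2,3) by linarith
  ultimately have "b - a = 0" by (auto dest: dvd_imp_le)
  then show ?thesis using assms(2) by simp
qed

text \<open>Number \<open>V\<close> by residues modulo \<open>p\<close> and use the cyclic intervals
  \<open>I i\<close> of length \<open>k\<close> starting at \<open>i\<close>. The interval that
  starts at \<open>m'\<close> and the one that ends at \<open>m'\<close> meet only in
  \<open>m'\<close>, since together they span \<open>2 * k - 1 < p\<close> residues. So one of them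
  contains \<open>m'\<close> and avoids \<open>m\<close>.\<close>

lemma ex_separating_subsets:
  fixes V :: "'a set"
  assumes "finite V" "0 < k" "2 * k \<le> card V"
  shows "\<exists>S. card S \<le> card V \<and> S \<subseteq> {B. B \<subseteq> V \<and> card B = k} \<and>
    (\<forall>y\<in>V. \<forall>y'\<in>V. y \<noteq> y' \<longrightarrow> (\<exists>B\<in>S. y \<notin> B \<and> y' \<in> B))"
proof -
  define p where "p = card V"
  have p: "2 * k \<le> p" "0 < p" using assms by (auto simp: p_def)
  obtain e where e: "bij_betw e {..<p} V"
    using ex_bij_betw_nat_finite[OF assms(1)] by (auto simp: p_def atLeast0LessThan)
  define I where "I i = (\<lambda>j. (i + j) mod p) ` {..<k}" for i
  have I_sub: "I i \<subseteq> {..<p}" for i using p by (auto simp: I_def)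
  have inj: "inj_on (\<lambda>j. (i + j) mod p) {..<k}" for i
  proof (rule linorder_inj_onI)
    fix x y assume "x < y" "x \<in> {..<k}" "y \<in> {..<k}"
    then show "(i + x) mod p \<noteq> (i + y) mod p"
      using nat_mod_eq_close[of "i + x" p "i + y"] p by auto
  qed auto
  have card_I: "card (I i) = k" for i
    using card_image[OF inj] by (simp add: I_def)
  have e_inj: "inj_on e {..<p}" and e_img: "e ` {..<p} = V"
    using e by (auto simp: bij_betw_def)
  have e_mem: "e m \<in> e ` I i \<longleftrightarrow> m \<in> I i" if "m < p" for m i
    using inj_on_image_mem_iff[OF e_inj _ I_sub] that by auto
  have sep: "\<exists>i<p. m \<notin> I i \<and> m' \<in> I i" if m: "m < p" "m' < p" "m \<noteq> m'" for m m'
  proof (cases "m \<in> I m'")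
    case False
    moreover have "m' \<in> I m'"
      using m assms(2) by (auto simp: I_def intro!: image_eqI[of _ _ 0])
    ultimately show ?thesis using m by auto
  next
    case True
    then obtain d where d: "m = (m' + d) mod p" "d < k" by (auto simp: I_def)
    with m have "0 < d" by (cases d) auto
    \<comment> \<open>The start of the interval that ends at \<open>m'\<close>. Adding
      \<open>p\<close> first keeps the subtraction from truncating.\<close>
    define i where "i = (m' + p - (k - 1)) mod p"
    have "m' = (i + (k - 1)) mod p"
    proof -
      have "(i + (k - 1)) mod p = (m' + p - (k - 1) + (k - 1)) mod p"
        unfolding i_def by (rule mod_add_left_eq)
      also have "m' + p - (k - 1) + (k - 1) = m' + p" using p by simp
      finally show ?thesis using m by simp
    qed
    then have "m' \<in> I i" unfolding I_def using assms(2) by (intro image_eqI[of _ _ "k - 1"]) auto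
    moreover have "m \<notin> I i"
    proof
      assume "m \<in> I i"
      then obtain j where j: "m = (i + j) mod p" "j < k" by (auto simp: I_def)
      have "(i + j) mod p = (m' + p - (k - 1) + j) mod p"
        unfolding i_def by (rule mod_add_left_eq)
      \<comment> \<open>The right-hand number is at least the left one and exceeds it by less than
        \<open>p\<close>, so congruence forces equality. But
        \<open>d \<le> k - 1 < p - (k - 1)\<close>.\<close>
      then have "(m' + d) mod p = (m' + p - (k - 1) + j) mod p" using d j by simp
      then have "m' + d = m' + p - (k - 1) + j"
        by (rule nat_mod_eq_close) (use d j p \<open>0 < d\<close> in linarith)+
      then show False using d p by linarith
    qed
    moreover have "i < p" using p by (simp add: i_def)
    ultimately show ?thesis by blast
  qed
  show ?thesis
  proof (intro exI[of _ "(\<lambda>i. e ` I i) ` {..<p}"] conjI ballI impI)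
    show "card ((\<lambda>i. e ` I i) ` {..<p}) \<le> card V"
      using card_image_le[of "{..<p}" "\<lambda>i. e ` I i"] by (simp add: p_def)
    show "(\<lambda>i. e ` I i) ` {..<p} \<subseteq> {B. B \<subseteq> V \<and> card B = k}"
      using I_sub e_img card_I by (auto simp: card_image[OF inj_on_subset[OF e_inj I_sub]])
    fix y y' assume "y \<in> V" "y' \<in> V" "y \<noteq> y'"
    then obtain m m' where "m < p" "m' < p" "m \<noteq> m'" "y = e m" "y' = e m'"
      using e_img by blast
    then show "\<exists>B\<in>(\<lambda>i. e ` I i) ` {..<p}. y \<notin> B \<and> y' \<in> B"
      using sep[of m m'] e_mem by (metis (no_types, lifting) image_eqI lessThan_iff)
  qed
qed

text \<open>Separation survives adding further \<open>k\<close>-sets. The separating family has at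
  most \<open>card V \<le> card W\<close> members, so it can be enlarged to exactly
  \<open>card W\<close> of the \<open>card V choose k\<close> available sets and then indexed by
  \<open>W\<close>.\<close>

lemma ex_separating_assignment:
  fixes V :: "'a set" and W :: "'b set"
  assumes "finite V" "finite W" "0 < k" "2 * k \<le> card V"
    and "card V \<le> card W" "card W \<le> card V choose k"
  shows "\<exists>A. inj_on A W \<and> (\<forall>z\<in>W. A z \<subseteq> V \<and> card (A z) = k) \<and>
    (\<forall>y\<in>V. \<forall>y'\<in>V. y \<noteq> y' \<longrightarrow> (\<exists>z\<in>W. y \<notin> A z \<and> y' \<in> A z))"
proof -
  obtain S where S: "card S \<le> card V" "S \<subseteq> {B. B \<subseteq> V \<and> card B = k}"
      "\<forall>y\<in>V. \<forall>y'\<in>V. y \<noteq> y' \<longrightarrow> (\<exists>B\<in>S. y \<notin> B \<and> y' \<in> B)"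
    using ex_separating_subsets[OF assms(1,3,4)] by blast
  have "finite {B. B \<subseteq> V \<and> card B = k}" using assms(1) by simp
  then obtain F where F: "S \<subseteq> F" "F \<subseteq> {B. B \<subseteq> V \<and> card B = k}" "card F = card W"
    using exists_subset_between[of S "card W" "{B. B \<subseteq> V \<and> card B = k}"] S assms n_subsets[OF assms(1), of k]
    by (metis (no_types, lifting) le_trans)
  have "finite F" using F(2) assms(1) by (rule_tac finite_subset) auto
  then obtain A where "bij_betw A W F"
    using finite_same_card_bij[OF assms(2)] F(3) by metis
  then have A: "inj_on A W" "A ` W = F" by (auto simp: bij_betw_def)
  show ?thesis
  proof (intro exI[of _ A] conjI ballI impI)
    fix z assume "z \<in> W"
    then have "A z \<in> F" using A(2) by blast
    then show "A z \<subseteq> V" "card (A z) = k" using F(2) by auto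
  next
    fix y y' assume "y \<in> V" "y' \<in> V" "y \<noteq> y'"
    then obtain B where "B \<in> S" "y \<notin> B" "y' \<in> B" using S(3) by blast
    then show "\<exists>z\<in>W. y \<notin> A z \<and> y' \<in> A z" using F(1) A(2) by blast
  qed (fact A(1))
qed

section \<open>Growth of the central binomial coefficient\<close>

text \<open>With \<open>k = n div 2\<close>, applying Pascal's rule twice gives
  \<open>(n choose (k - 1)) + 2 * (n choose k) + (n choose Suc k)\<close> on the right. One copy of
  \<open>n choose k\<close> cancels, the other is at least 3, and \<open>n choose Suc k\<close> is
  at least 1.\<close>

lemma central_binomial_step:
  assumes "3 \<le> n"
  shows "4 + (n choose (n div 2)) \<le> Suc (Suc n) choose Suc (n div 2)"
proof -
  define k where "k = n div 2"
  have k: "1 \<le> k" "Suc k \<le> n" using assms by (auto simp: k_def)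
  \<comment> \<open>The central coefficient dominates \<open>n choose 1 = n\<close>.\<close>
  have "3 \<le> n choose k"
    using binomial_maximum[of n 1] assms by (simp add: k_def)
  moreover have "1 \<le> n choose Suc k"
    using zero_less_binomial[OF k(2)] by linarith
  moreover have "Suc n choose k = (n choose (k - 1)) + (n choose k)"
    using k by (cases k) auto
  ultimately show ?thesis by (simp flip: k_def)
qed

section \<open>Distance two in digraphs\<close>

lemma digraph_dist_ge_2:
  assumes "pair_wf_digraph D" "u \<noteq> v" "(u, v) \<notin> parcs D"
  shows "2 \<le> digraph_dist D u v"
proof -
  interpret pair_wf_digraph D by fact
  have "2 \<le> awalk_cost (\<lambda>_. 1) es" if "awalk u es v" for es
  proof (cases es rule: list.exhaust[case_names Nil Cons])
    case Nil
    then show ?thesis using that assms by (simp add: awalk_Nil_iff)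
  next
    case (Cons e es')
    show ?thesis
    proof (cases es')
      case Nil
      then show ?thesis using that assms Cons by (auto simp: awalk_simps)
    next
      case (Cons e' es'')
      then show ?thesis using \<open>es = e # es'\<close>
        by (simp add: awalk_cost_def sum_list_triv)
    qed
  qed
  then show ?thesis unfolding digraph_dist_def \<mu>_def
    by (intro INF_greatest) (metis ereal_less_eq(3) mem_Collect_eq numeral_eq_ereal)
qed

lemma short_walks_imp_diameter_le_2:
  assumes "pair_wf_digraph D" "pverts D \<noteq> {}"
    and short: "\<And>u v. u \<in> pverts D \<Longrightarrow> v \<in> pverts D \<Longrightarrow> u \<noteq> v \<Longrightarrow>
      (u, v) \<in> parcs D \<or> (\<exists>w. (u, w) \<in> parcs D \<and> (w, v) \<in> parcs D)"
  shows "strongly_connected (with_proj D)" "diameter D \<le> 2"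
proof -
  interpret pair_wf_digraph D by fact
  have walk: "\<exists>es. awalk u es v \<and> awalk_cost (\<lambda>_. 1) es \<le> 2"
    if uv: "u \<in> pverts D" "v \<in> pverts D" for u v
  proof -
    consider "u = v" | "(u, v) \<in> parcs D"
      | w where "(u, w) \<in> parcs D" "(w, v) \<in> parcs D"
      using short uv by blast
    then show ?thesis
    proof cases
      case 1
      then show ?thesis using uv by (intro exI[of _ "[]"]) (simp add: awalk_simps)
    next
      case 2
      then show ?thesis using uv by (intro exI[of _ "[(u, v)]"]) (simp add: awalk_simps)
    next
      case 3
      then show ?thesis using uv by (intro exI[of _ "[(u, w), (w, v)]"]) (simp add: awalk_simps)
    qed
  qed
  show "strongly_connected (with_proj D)"
    using walk assms(2) by (intro strongly_connectedI) (auto simp: reachable_awalk)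
  have "digraph_dist D u v \<le> 2" if uv: "u \<in> pverts D" "v \<in> pverts D" for u v
  proof -
    obtain es where es: "awalk u es v" "awalk_cost (\<lambda>_. 1) es \<le> 2" using walk[OF uv] by blast
    have "digraph_dist D u v \<le> ereal (awalk_cost (\<lambda>_. 1) es)"
      unfolding digraph_dist_def using es(1) by (rule min_cost_le_walk_cost)
    also have "\<dots> \<le> 2" using es(2) by (metis ereal_less_eq(3) numeral_eq_ereal)
    finally show ?thesis .
  qed
  then show "diameter D \<le> 2"
    unfolding diameter_def by (auto intro!: SUP_least)
qed

text \<open>An orientation creates no new arcs, so a nonadjacent pair stays at distance at least 2
  in each of them. The bound also holds when no strong orientation exists, the infimum then being
  \<infinity>.\<close>

lemma oriented_diameter_ge_2:
  assumes "pair_wf_digraph G" "u \<in> pverts G" "v \<in> pverts G" "u \<noteq> v" "(u, v) \<notin> parcs G"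
  shows "2 \<le> oriented_diameter G"
  unfolding oriented_diameter_def
proof (rule INF_greatest)
  fix D assume "D \<in> {D. strong_orientation D G}"
  then have D: "pverts D = pverts G" "parcs D \<subseteq> parcs G"
    by (auto simp: strong_orientation_def orientation_def)
  interpret G: pair_wf_digraph G by fact
  have "pair_wf_digraph D"
  proof unfold_locales
    fix e assume "e \<in> parcs D"
    then have "e \<in> parcs G" using D(2) by blast
    then show "fst e \<in> pverts D" "snd e \<in> pverts D"
      using G.arc_fst_in_verts G.arc_snd_in_verts D(1) by auto
  qed
  then have "2 \<le> digraph_dist D u v"
    by (rule digraph_dist_ge_2) (use assms(4,5) D(2) in auto)
  also have "\<dots> \<le> diameter D"
    unfolding diameter_def using assms(2,3) D(1) by (intro SUP_upper2[of "(u, v)"]) auto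
  finally show "2 \<le> diameter D" .
qed

section \<open>The orientation and its paths of length at most two\<close>

text \<open>Working with a bare arc relation \<open>R\<close> keeps digraph notions out of the case
  analysis. The bound \<open>2 \<le> k\<close> lets each \<open>A z\<close> avoid a prescribed
  vertex, and \<open>k < card V\<close> leaves a vertex outside each \<open>A z\<close>.\<close>

lemma ex_short_tripartite_orientation:
  fixes V W :: "'a set"
  assumes dist: "a \<noteq> b" "a \<noteq> c" "b \<noteq> c" and disj: "{a, b, c} \<inter> V = {}" "{a, b, c} \<inter> W = {}" "V \<inter> W = {}"
    and A: "inj_on A W" "\<And>z. z \<in> W \<Longrightarrow> A z \<subseteq> V" "\<And>z. z \<in> W \<Longrightarrow> card (A z) = k"
    and k: "2 \<le> k" "k < card V"
    and sep: "\<And>y y'. y \<in> V \<Longrightarrow> y' \<in> V \<Longrightarrow> y \<noteq> y' \<Longrightarrow> \<exists>z\<in>W. y \<notin> A z \<and> y' \<in> A z"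
  shows "\<exists>R. R \<union> R\<inverse> = {a, b, c} \<times> V \<union> V \<times> {a, b, c} \<union> {a, b, c} \<times> W \<union> W \<times> {a, b, c} \<union> V \<times> W \<union> W \<times> V \<and>
    R \<inter> R\<inverse> = {} \<and>
    (\<forall>u \<in> {a, b, c} \<union> V \<union> W. \<forall>v \<in> {a, b, c} \<union> V \<union> W. u \<noteq> v \<longrightarrow>
      (u, v) \<in> R \<or> (\<exists>w. (u, w) \<in> R \<and> (w, v) \<in> R))"
proof -
  have finV: "finite V" using k by (intro card_ge_0_finite) auto
  have finA: "finite (A z)" if "z \<in> W" for z using A(2)[OF that] finV by (rule finite_subset)
  obtain y0 where y0: "y0 \<in> V" using k by fastforce
  have ex_other: "\<exists>y\<in>V. y \<noteq> y'" for y'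
  proof (rule ccontr)
    assume "\<not> ?thesis"
    then have "V \<subseteq> {y'}" by blast
    then have "card V \<le> 1" using card_mono[of "{y'}" V] by simp
    then show False using k by simp
  qed
  have ex_A: "\<exists>y\<in>A z. y \<noteq> y'" if "z \<in> W" for z y'
  proof (rule ccontr)
    assume "\<not> ?thesis"
    then have "A z \<subseteq> {y'}" by blast
    then have "card (A z) \<le> 1" using card_mono[of "{y'}" "A z"] by simp
    then show False using k A(3)[OF that] by simp
  qed
  have ex_not_A: "\<exists>y\<in>V. y \<notin> A z" if "z \<in> W" for z
  proof (rule ccontr)
    assume "\<not> ?thesis"
    then have "A z = V" using A(2)[OF that] by blast
    then show False using k A(3)[OF that] by simp
  qed
  have antichain: "\<exists>y\<in>A z. y \<notin> A z'" if "z \<in> W" "z' \<in> W" "z \<noteq> z'" for z z'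
  proof (rule ccontr)
    assume "\<not> ?thesis"
    then have "A z \<subseteq> A z'" by blast
    then have "A z = A z'" using card_subset_eq[OF finA] A(3) that by metis
    then show False using A(1) that by (auto dest: inj_onD)
  qed
  \<comment> \<open>The condition \<open>y0 \<notin> A z1\<close> gives the arc from
    \<open>y0\<close> to \<open>z1\<close>. It links the two exceptional neighbours of
    \<open>c\<close> through the paths \<open>y0, z1, c\<close> and
    \<open>c, y0, z1\<close>.\<close>
  obtain z1 where z1: "z1 \<in> W" "y0 \<notin> A z1" using ex_other[of y0] sep y0 by metis
  \<comment> \<open>Needed for paths from \<open>c\<close> to \<open>y\<close>, which must leave
    through some \<open>z\<close> other than \<open>z1\<close>. Separating a suitable
    \<open>y'\<close> in \<open>A z1\<close> from \<open>y\<close> ensures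
    \<open>z \<noteq> z1\<close>, because \<open>y' \<notin> A z\<close>.\<close>
  have cover: "\<exists>z\<in>W. z \<noteq> z1 \<and> y \<in> A z" if y: "y \<in> V" for y
  proof -
    obtain y' where y': "y' \<in> A z1" "y' \<noteq> y" using ex_A[OF z1(1)] by blast
    then obtain z where "z \<in> W" "y' \<notin> A z" "y \<in> A z" using sep y A(2)[OF z1(1)] by blast
    then show ?thesis using y' by metis
  qed
  have ex_avoid: "\<exists>z\<in>W. y \<notin> A z" if "y \<in> V" for y using ex_other[of y] sep that by metis
  define R where "R = {a} \<times> V \<union> V \<times> {b} \<union> {b} \<times> W \<union> W \<times> {a}
    \<union> {(z, y). z \<in> W \<and> y \<in> A z} \<union> {(y, z). y \<in> V \<and> z \<in> W \<and> y \<notin> A z}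
    \<union> {(c, y0)} \<union> (V - {y0}) \<times> {c} \<union> {(z1, c)} \<union> {c} \<times> (W - {z1})"
  define short where "short u v \<longleftrightarrow> (u, v) \<in> R \<or> (\<exists>w. (u, w) \<in> R \<and> (w, v) \<in> R)" for u v
  have shortI: "short u v" if "(u, w) \<in> R" "(w, v) \<in> R" for u v w
    using that by (auto simp: short_def)
  have arcs: "\<And>y. y \<in> V \<Longrightarrow> (a, y) \<in> R" "\<And>y. y \<in> V \<Longrightarrow> (y, b) \<in> R"
    "\<And>z. z \<in> W \<Longrightarrow> (b, z) \<in> R" "\<And>z. z \<in> W \<Longrightarrow> (z, a) \<in> R"
    "\<And>z y. z \<in> W \<Longrightarrow> y \<in> A z \<Longrightarrow> (z, y) \<in> R"
    "\<And>z y. y \<in> V \<Longrightarrow> z \<in> W \<Longrightarrow> y \<notin> A z \<Longrightarrow> (y, z) \<in> R"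
    "(c, y0) \<in> R" "\<And>y. y \<in> V \<Longrightarrow> y \<noteq> y0 \<Longrightarrow> (y, c) \<in> R"
    "(z1, c) \<in> R" "\<And>z. z \<in> W \<Longrightarrow> z \<noteq> z1 \<Longrightarrow> (c, z) \<in> R"
    by (auto simp: R_def)
  have arc_short: "short u v" if "(u, v) \<in> R" for u v using that by (simp add: short_def)
  have shorts: "short a b" "short a c" "short b a" "short b c" "short c a" "short c b"
    using shortI arcs y0 z1 ex_other[of y0] cover[OF y0] by metis+
  \<comment> \<open>Both \<open>b\<close> and \<open>c\<close> reach \<open>y\<close> through the
    \<open>z\<close> given by \<open>cover\<close>; \<open>y\<close> reaches \<open>a\<close>
    through a \<open>z\<close> with \<open>y \<notin> A z\<close>.\<close>
  have a_V: "short a y" and b_V: "short b y" and c_V: "short c y"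
    and V_a: "short y a" and V_b: "short y b" and V_c: "short y c" if "y \<in> V" for y
    using shortI arc_short arcs z1 cover[OF that] ex_avoid[OF that] that by metis+
  \<comment> \<open>\<open>a\<close> reaches \<open>z\<close> through a vertex outside
    \<open>A z\<close>. Conversely \<open>z\<close> reaches \<open>b\<close> through any vertex of
    \<open>A z\<close>, and \<open>c\<close>, if \<open>z \<noteq> z1\<close>, through one other
    than \<open>y0\<close>.\<close>
  have a_W: "short a z" and b_W: "short b z" and c_W: "short c z"
    and W_a: "short z a" and W_b: "short z b" and W_c: "short z c" if "z \<in> W" for z
    using shortI arc_short arcs y0 z1 ex_not_A[OF that] ex_A[OF that, of y0] A(2)[OF that, THEN subsetD] that
    by metis+
  \<comment> \<open>The paths \<open>y, b, z\<close> and \<open>z, a, y\<close> work whatever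
    \<open>A z\<close> is.\<close>
  have V_W: "short y z" and W_V: "short z y" if "y \<in> V" "z \<in> W" for y z
    using shortI arcs that by metis+
  \<comment> \<open>Separation and the antichain property are exactly the existence of the middle
    vertex here and in \<open>W_W\<close>.\<close>
  have V_V: "short y y'" if "y \<in> V" "y' \<in> V" "y \<noteq> y'" for y y'
    using shortI arcs sep[OF that] that by metis
  have W_W: "short z z'" if "z \<in> W" "z' \<in> W" "z \<noteq> z'" for z z'
    using shortI arcs antichain[OF that] A(2)[OF that(1), THEN subsetD] that by metis
  have "short u v" if "u \<in> {a, b, c} \<union> V \<union> W" "v \<in> {a, b, c} \<union> V \<union> W" "u \<noteq> v" for u v
    using that by (elim UnE insertE emptyE)
      (simp_all add: shorts a_V b_V c_V V_a V_b V_c a_W b_W c_W W_a W_b W_c V_W W_V V_V W_W)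
  moreover have "R \<inter> R\<inverse> = {}"
  proof -
    have "a \<notin> V" "b \<notin> V" "c \<notin> V" "a \<notin> W" "b \<notin> W" "c \<notin> W" "\<And>x. x \<in> V \<Longrightarrow> x \<notin> W"
      using disj by auto
    then show ?thesis
      unfolding R_def using dist y0 z1 A(2)[THEN subsetD] by auto
  qed
  moreover have "R \<union> R\<inverse> = {a, b, c} \<times> V \<union> V \<times> {a, b, c} \<union> {a, b, c} \<times> W \<union> W \<times> {a, b, c} \<union> V \<times> W \<union> W \<times> V"
    (is "_ = ?E")
  proof
    show "R \<union> R\<inverse> \<subseteq> ?E"
      unfolding R_def using y0 z1 A(2)[THEN subsetD] by auto
    have XV: "{a, b, c} \<times> V \<subseteq> R \<union> R\<inverse>"
    proof clarify
      fix x y assume "x \<in> {a, b, c}" "y \<in> V" "(x, y) \<notin> R"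
      then show "(y, x) \<in> R" using arcs by (elim insertE emptyE) metis+
    qed
    have XW: "{a, b, c} \<times> W \<subseteq> R \<union> R\<inverse>"
    proof clarify
      fix x z assume "x \<in> {a, b, c}" "z \<in> W" "(x, z) \<notin> R"
      then show "(z, x) \<in> R" using arcs by (elim insertE emptyE) metis+
    qed
    have VW: "V \<times> W \<subseteq> R \<union> R\<inverse>" using arcs(5,6) by auto
    have swap: "Q \<times> P \<subseteq> R \<union> R\<inverse>" if "P \<times> Q \<subseteq> R \<union> R\<inverse>" for P Q
      using that by blast
    show "?E \<subseteq> R \<union> R\<inverse>"
      by (intro Un_least XV XW VW swap[OF XV] swap[OF XW] swap[OF VW])
  qed
  ultimately show ?thesis unfolding short_def by blast
qed

theorem theorem5p6:
  fixes p q :: nat and G :: "'a pair_pre_digraph"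
  assumes "p \<ge> 5" and "p \<le> q" and "q \<le> 4 + ((p - 2) choose ((p - 2) div 2))"
    and "complete_tripartite 3 p q G"
  shows "oriented_diameter G = 2"
proof -
  obtain U V W where G: "pair_graph G" "pverts G = U \<union> V \<union> W"
      "U \<inter> V = {}" "U \<inter> W = {}" "V \<inter> W = {}" "card U = 3" "card V = p" "card W = q"
      "parcs G = U \<times> V \<union> V \<times> U \<union> U \<times> W \<union> W \<times> U \<union> V \<times> W \<union> W \<times> V"
    using assms(4) by (auto simp: complete_tripartite_def)
  obtain a b c where U: "U = {a, b, c}" and dist: "a \<noteq> b" "a \<noteq> c" "b \<noteq> c"
    using G(6) by (auto simp: card_3_iff)
  interpret G: pair_graph G by fact
  have G_wf: "pair_wf_digraph G" by unfold_locales
  define k where "k = p div 2"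
  \<comment> \<open>These identities turn the bound on \<open>q\<close> into
    \<open>p choose k\<close>; \<open>p \<ge> 5\<close> supplies
    \<open>3 \<le> p - 2\<close>.\<close>
  have "Suc (Suc (p - 2)) = p" "Suc ((p - 2) div 2) = k" using assms(1) by (auto simp: k_def)
  then have "4 + ((p - 2) choose ((p - 2) div 2)) \<le> p choose k"
    using central_binomial_step[of "p - 2"] assms(1) by simp
  then have qk: "q \<le> p choose k" using assms(3) by linarith
  have "finite V" "finite W" using G assms(1,2) by (auto intro!: card_ge_0_finite)
  moreover have k: "2 \<le> k" "2 * k \<le> p" "k < p" using assms(1) by (auto simp: k_def)
  ultimately obtain A where A: "inj_on A W" "\<forall>z\<in>W. A z \<subseteq> V \<and> card (A z) = k"
      "\<forall>y\<in>V. \<forall>y'\<in>V. y \<noteq> y' \<longrightarrow> (\<exists>z\<in>W. y \<notin> A z \<and> y' \<in> A z)"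
    using ex_separating_assignment[of V W k] G assms(2) qk by auto
  have "\<exists>R. R \<union> R\<inverse> = parcs G \<and> R \<inter> R\<inverse> = {} \<and>
      (\<forall>u\<in>pverts G. \<forall>v\<in>pverts G. u \<noteq> v \<longrightarrow> (u, v) \<in> R \<or> (\<exists>w. (u, w) \<in> R \<and> (w, v) \<in> R))"
    unfolding G(2,9) U
  proof (rule ex_short_tripartite_orientation[OF dist G(3-5)[unfolded U] A(1)])
    show "2 \<le> k" "k < card V" using k G(7) by simp_all
  qed (use A(2,3) in blast)+
  then obtain R where R: "R \<union> R\<inverse> = parcs G" "R \<inter> R\<inverse> = {}"
      "\<forall>u\<in>pverts G. \<forall>v\<in>pverts G. u \<noteq> v \<longrightarrow> (u, v) \<in> R \<or> (\<exists>w. (u, w) \<in> R \<and> (w, v) \<in> R)"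
    by blast
  define D where "D = \<lparr>pverts = pverts G, parcs = R\<rparr>"
  have "pair_wf_digraph D"
  proof unfold_locales
    fix e assume "e \<in> parcs D"
    then have "e \<in> parcs G" using R(1) by (auto simp: D_def)
    then show "fst e \<in> pverts D" "snd e \<in> pverts D"
      using G.arc_fst_in_verts G.arc_snd_in_verts by (auto simp: D_def)
  qed
  moreover have "pverts D \<noteq> {}" by (simp add: D_def G U)
  ultimately have "strongly_connected (with_proj D)" "diameter D \<le> 2"
    by (rule short_walks_imp_diameter_le_2; use R(3) in \<open>simp add: D_def\<close>)+
  moreover have "orientation D G" using R by (simp add: D_def orientation_def)
  ultimately have "oriented_diameter G \<le> 2"
    unfolding oriented_diameter_def by (intro INF_lower2[of D]) (auto simp: strong_orientation_def)
  moreover have "2 \<le> oriented_diameter G"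
    \<comment> \<open>\<open>a\<close> and \<open>b\<close> lie in the same part, hence are not
      adjacent.\<close>
    by (rule oriented_diameter_ge_2[OF G_wf, of a b]) (use G U dist in auto)
  ultimately show ?thesis by (rule antisym)
qed

end
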